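(* Let $\mathcal{C}\subseteq\mathbb{R}^n$ be a non-decomposable full-dimensional pointed polyhedral cone with extreme rays $R_1,\dots,R_p$. Then: (i) $\mathrm{GL}(\mathcal{C})\cong\mathbb{R}_+^*\times\mathrm{Proj}(\mathcal{C})$, where $\mathbb{R}_+^*$ is the multiplicative group of positive reals; (ii) there exist vectors $v_1,\dots,v_p$ with $R_i=\mathbb{R}_+v_i$ for all $i$ such that $\mathrm{Lin}_v(\mathcal{C})=\mathrm{Proj}(\mathcal{C})$.
   Context: A polyhedral cone is the set of vectors satisfying finitely many homogeneous linear inequalities; it is assumed full-dimensional and containing no nontrivial linear subspace, hence generated by its extreme rays. It is decomposable if $\mathbb{R}^n=V_1\oplus V_2$ for nonzero subspaces $V_1,V_2$ such that every extreme ray lies in $V_1$ or in $V_2$; otherwise non-decomposable. $\mathrm{GL}(\mathcal{C})=\{A\in\mathrm{GL}_n(\mathbb{R}): A\mathcal{C}=\mathcal{C}\}$. $\mathrm{Proj}(\mathcal{C})$ is the group of $\sigma\in\mathrm{Sym}(p)$ such that some $A\in\mathrm{GL}(\mathcal{C})$ has $AR_i=R_{\sigma(i)}$ for all $i$. For generators $v=\{v_1,\dots,v_p\}$ of the rays, $\mathrm{Lin}_v(\mathcal{C})$ is the group of $\sigma\in\mathrm{Sym}(p)$ such that some $A\in\mathrm{GL}_n(\mathbb{R})$ has $Av_i=v_{\sigma(i)}$ for all $i$. *)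

theory Defs
  imports "HOL-Analysis.Analysis" "HOL-Algebra.Sym_Groups"
begin

definition polyhedral_cone :: "(real ^ 'n) set \<Rightarrow> bool" where
  "polyhedral_cone C \<longleftrightarrow> (\<exists>N. finite N \<and> C = {x. \<forall>a\<in>N. a \<bullet> x \<ge> 0})"

definition full_dimensional :: "(real ^ 'n) set \<Rightarrow> bool" where
  "full_dimensional C \<longleftrightarrow> aff_dim C = int CARD('n)"

definition pointed :: "(real ^ 'n) set \<Rightarrow> bool" where
  "pointed C \<longleftrightarrow> (\<forall>V. subspace V \<and> V \<subseteq> C \<longrightarrow> V = {0})"

definition ray :: "real ^ 'n \<Rightarrow> (real ^ 'n) set" where
  "ray v = {t *\<^sub>R v | t. t \<ge> 0}"

definition extreme_ray :: "(real ^ 'n) set \<Rightarrow> (real ^ 'n) set \<Rightarrow> bool" where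
  "extreme_ray R C \<longleftrightarrow> R face_of C \<and> (\<exists>v. v \<noteq> 0 \<and> R = ray v)"

definition decomposable :: "(real ^ 'n) set \<Rightarrow> bool" where
  "decomposable C \<longleftrightarrow>
     (\<exists>V W. subspace V \<and> subspace W \<and> V \<noteq> {0} \<and> W \<noteq> {0} \<and>
        V \<inter> W = {0} \<and> {x + y | x y. x \<in> V \<and> y \<in> W} = UNIV \<and>
        (\<forall>R. extreme_ray R C \<longrightarrow> R \<subseteq> V \<or> R \<subseteq> W))"

definition general_linear_group :: "(real ^ 'n ^ 'n) monoid" where
  "general_linear_group = \<lparr>carrier = {A. invertible A}, mult = (**), one = mat 1\<rparr>"

definition GL_cone :: "(real ^ 'n) set \<Rightarrow> (real ^ 'n ^ 'n) monoid" where
  "GL_cone C = general_linear_group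
     \<lparr>carrier := {A \<in> carrier general_linear_group. (*v) A ` C = C}\<rparr>"

definition pos_real_group :: "real monoid" where
  "pos_real_group = \<lparr>carrier = {x. x > 0}, mult = (*), one = 1\<rparr>"

text \<open>The rays and their generators are indexed by \<open>{1..p}\<close>, the set on which the
  elements of \<^term>\<open>sym_group p\<close> act; values of \<open>R\<close> and \<open>v\<close> at other indices are irrelevant.\<close>

definition Proj_group :: "(real ^ 'n) set \<Rightarrow> nat \<Rightarrow> (nat \<Rightarrow> (real ^ 'n) set) \<Rightarrow> (nat \<Rightarrow> nat) monoid" where
  "Proj_group C p R = (sym_group p)
     \<lparr>carrier := {\<sigma> \<in> carrier (sym_group p).
        \<exists>A \<in> carrier (GL_cone C). \<forall>i\<in>{1..p}. (*v) A ` R i = R (\<sigma> i)}\<rparr>"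

definition Lin_group :: "nat \<Rightarrow> (nat \<Rightarrow> real ^ 'n) \<Rightarrow> (nat \<Rightarrow> nat) monoid" where
  "Lin_group p v = (sym_group p)
     \<lparr>carrier := {\<sigma> \<in> carrier (sym_group p).
        \<exists>A \<in> carrier general_linear_group. \<forall>i\<in>{1..p}. A *v v i = v (\<sigma> i)}\<rparr>"

end

theory Submission
  imports Defs
begin

text \<open>
  An automorphism fixing every extreme ray is diagonal on generators of the rays; if it had two
  distinct eigenvalues, its eigenspaces would decompose the cone, so it is a positive scalar.
  The homomorphism \<open>A \<mapsto> \<bar>det A\<bar> powr (1 / n)\<close> restricts to the identity on positive scalars, and
  hence together with the induced permutation of the rays it gives the isomorphism of (i). Its
  kernel is thus a finite group isomorphic to the projective group, and averaging arbitrary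
  generators over this group yields the vectors of (ii). That a pointed polyhedral cone is
  generated by its extreme rays follows from the Krein-Milman theorem for a compact slice.
\<close>

section \<open>Rays and their images under matrices\<close>

lemma ray_nonneg_mult: "x \<in> ray v \<Longrightarrow> 0 \<le> t \<Longrightarrow> t *\<^sub>R x \<in> ray v"
  unfolding ray_def by (auto intro: mult_nonneg_nonneg)

lemma self_in_ray: "v \<in> ray v"
  unfolding ray_def by (auto intro!: exI[of _ 1])

lemma ray_scaleR:
  assumes "0 < t"
  shows "ray (t *\<^sub>R v) = ray v"
proof
  show "ray (t *\<^sub>R v) \<subseteq> ray v"
  proof
    fix x assume "x \<in> ray (t *\<^sub>R v)"
    then obtain s where "s \<ge> 0" "x = (s * t) *\<^sub>R v" unfolding ray_def by auto
    then show "x \<in> ray v" using ray_nonneg_mult[OF self_in_ray, of "s * t"] assms by simp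
  qed
  show "ray v \<subseteq> ray (t *\<^sub>R v)"
  proof
    fix x assume "x \<in> ray v"
    then obtain s where "s \<ge> 0" "x = s *\<^sub>R v" unfolding ray_def by auto
    then have "x = (s / t) *\<^sub>R (t *\<^sub>R v)" "s / t \<ge> 0" using assms by auto
    then show "x \<in> ray (t *\<^sub>R v)" unfolding ray_def by blast
  qed
qed

lemma in_ray_nonzeroE:
  assumes "x \<in> ray v" "x \<noteq> 0"
  obtains t where "0 < t" "x = t *\<^sub>R v"
  using assms unfolding ray_def by (auto simp: order_le_less)

lemma matrix_image_ray: "(*v) A ` ray v = ray (A *v v)"
proof -
  have "(*v) A ` ray v = (\<lambda>t. A *v (t *\<^sub>R v)) ` {t. 0 \<le> t}"
    unfolding ray_def by blast
  then show ?thesis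
    unfolding ray_def by (auto simp: matrix_vector_mult_scaleR)
qed

lemma convex_ray: "convex (ray (v :: real ^ 'n))"
proof (rule convexI)
  fix x y :: "real ^ 'n" and a b :: real
  assume "x \<in> ray v" "y \<in> ray v" and ab: "0 \<le> a" "0 \<le> b"
  then obtain s t where "0 \<le> s" "x = s *\<^sub>R v" "0 \<le> t" "y = t *\<^sub>R v"
    unfolding ray_def by auto
  with ab show "a *\<^sub>R x + b *\<^sub>R y \<in> ray v"
    unfolding ray_def
    by (auto intro!: exI[of _ "a * s + b * t"] simp: scaleR_add_left)
qed

section \<open>Pointed polyhedral cones and their generation by extreme rays\<close>

lemma polyhedral_cone_convex: "polyhedral_cone C \<Longrightarrow> convex C"
  unfolding polyhedral_cone_def convex_def by (auto simp: inner_add_right)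

lemma polyhedral_cone_closed: "polyhedral_cone C \<Longrightarrow> closed C"
  unfolding polyhedral_cone_def
  by (auto simp: Collect_ball_eq intro!: closed_INT closed_Collect_le continuous_intros)

lemma polyhedral_cone_scaleR: "polyhedral_cone C \<Longrightarrow> x \<in> C \<Longrightarrow> 0 \<le> t \<Longrightarrow> t *\<^sub>R x \<in> C"
  unfolding polyhedral_cone_def by auto

text \<open>The sum of the facet normals is strictly positive on the cone minus the origin.\<close>

lemma pointed_cone_positive_functional:
  fixes C :: "(real ^ 'n) set"
  assumes "polyhedral_cone C" "pointed C"
  obtains f where "\<And>x. x \<in> C \<Longrightarrow> x \<noteq> 0 \<Longrightarrow> 0 < f \<bullet> x"
proof -
  obtain N where N: "finite N" "C = {x. \<forall>a\<in>N. a \<bullet> x \<ge> 0}"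
    using assms(1) unfolding polyhedral_cone_def by blast
  have "0 < (\<Sum>N) \<bullet> x" if x: "x \<in> C" "x \<noteq> 0" for x
  proof (rule ccontr)
    assume neg: "\<not> 0 < (\<Sum>N) \<bullet> x"
    have nonneg: "a \<bullet> x \<ge> 0" if "a \<in> N" for a using that x N by auto
    have "(\<Sum>a\<in>N. a \<bullet> x) = 0"
      using neg nonneg by (simp add: inner_sum_left sum_nonneg order_antisym)
    then have "a \<bullet> x = 0" if "a \<in> N" for a
      using that N(1) nonneg by (simp add: sum_nonneg_eq_0_iff)
    \<comment> \<open>If every normal vanishes at x, the whole line through x lies in the cone,
      against pointedness.\<close>
    then have "span {x} \<subseteq> C" by (auto simp: span_singleton N(2))
    then have "span {x} = {0}" using assms(2) unfolding pointed_def by blast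
    then show False using x(2) span_base[of x "{x}"] by auto
  qed
  then show thesis using that by blast
qed

text \<open>A segment of the cone meeting the ray in its interior projects radially to a segment of
  the slice \<open>f \<bullet> x = 1\<close> around v. Extremality of v collapses that segment, so
  both endpoints are multiples of v. An endpoint at the origin has no projection and is treated
  apart.\<close>

lemma extreme_point_slice_extreme_ray:
  fixes C :: "(real ^ 'n) set"
  assumes C: "polyhedral_cone C"
    and pos: "\<And>x. x \<in> C \<Longrightarrow> x \<noteq> 0 \<Longrightarrow> 0 < f \<bullet> x"
    and v: "v extreme_point_of {x \<in> C. f \<bullet> x = 1}"
  shows "extreme_ray (ray v) C"
proof -
  have vC: "v \<in> C" "f \<bullet> v = 1" using v unfolding extreme_point_of_def by auto
  have sub: "ray v \<subseteq> C"
    using polyhedral_cone_scaleR[OF C vC(1)] unfolding ray_def by auto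
  have ext: "a \<in> ray v \<and> b \<in> ray v"
    if ab: "a \<in> C" "b \<in> C" "x \<in> ray v" "x \<in> open_segment a b" for a b x
  proof -
    obtain u where u: "0 < u" "u < 1" "x = (1 - u) *\<^sub>R a + u *\<^sub>R b"
      using ab(4) unfolding in_segment by auto
    have fa: "0 \<le> f \<bullet> a" and fb: "0 \<le> f \<bullet> b"
      using pos ab(1,2) by (metis inner_zero_right order_le_less)+
    obtain t where t: "t \<ge> 0" "x = t *\<^sub>R v" using ab(3) unfolding ray_def by auto
    \<comment> \<open>Applying f turns the position of x on the ray into the weighted mean of the
      heights of a and b.\<close>
    have ft: "t = (1 - u) * (f \<bullet> a) + u * (f \<bullet> b)"
      using arg_cong[OF u(3), of "\<lambda>z. f \<bullet> z"] t(2) vC(2) by (simp add: inner_add_right)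
    consider "a = 0" | "b = 0" | "a \<noteq> 0" "b \<noteq> 0" by blast
    then show ?thesis
    proof cases
      case 1
      have "b = (1 / u) *\<^sub>R x" using u 1 by simp
      then have "b \<in> ray v" using ray_nonneg_mult[OF ab(3), of "1 / u"] u by simp
      moreover have "a \<in> ray v" using 1 ray_nonneg_mult[OF ab(3), of 0] by simp
      ultimately show ?thesis by simp
    next
      case 2
      have "a = (1 / (1 - u)) *\<^sub>R x" using u 2 by simp
      then have "a \<in> ray v" using ray_nonneg_mult[OF ab(3), of "1 / (1 - u)"] u by simp
      moreover have "b \<in> ray v" using 2 ray_nonneg_mult[OF ab(3), of 0] by simp
      ultimately show ?thesis by simp
    next
      case 3
      then have pa: "0 < f \<bullet> a" and pb: "0 < f \<bullet> b" using pos ab by auto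
      then have tp: "0 < t" using ft u by (simp add: add_pos_pos)
      define a' b' where "a' = (1 / (f \<bullet> a)) *\<^sub>R a" and "b' = (1 / (f \<bullet> b)) *\<^sub>R b"
      have mem: "a' \<in> {x \<in> C. f \<bullet> x = 1}" "b' \<in> {x \<in> C. f \<bullet> x = 1}"
        unfolding a'_def b'_def using ab pa pb polyhedral_cone_scaleR[OF C] by auto
      \<comment> \<open>Dividing x by its height t and rewriting a, b through their normalisations
        gives b' exactly this weight; by \<open>ft\<close> the weights sum to 1.\<close>
      define s where "s = u * (f \<bullet> b) / t"
      have s: "0 < s" "1 - s = (1 - u) * (f \<bullet> a) / t"
        unfolding s_def using ft tp pb u by (auto simp: field_simps)
      then have s1: "s < 1"
        using pa u tp by (smt (verit) divide_pos_pos mult_pos_pos)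
      have "v = (1 / t) *\<^sub>R x" using t(2) tp by simp
      also have "\<dots> = (1 - s) *\<^sub>R a' + s *\<^sub>R b'"
        unfolding a'_def b'_def s(2) u(3) unfolding s_def using pa pb
        by (simp add: scaleR_add_right)
      finally have comb: "v = (1 - s) *\<^sub>R a' + s *\<^sub>R b'" .
      have eq: "a' = b'"
      proof (rule ccontr)
        assume "a' \<noteq> b'"
        then have "v \<in> open_segment a' b'" unfolding in_segment using comb s s1 by auto
        then show False using v mem unfolding extreme_point_of_def by blast
      qed
      have "a' = v" "b' = v" using comb eq by (simp_all flip: scaleR_add_left)
      then have "a = (f \<bullet> a) *\<^sub>R v"
        unfolding a'_def using pa by auto
      moreover have "b = (f \<bullet> b) *\<^sub>R v"
        using \<open>b' = v\<close> unfolding b'_def using pb by auto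
      ultimately show ?thesis using fa fb unfolding ray_def by blast
    qed
  qed
  have "ray v face_of C"
    unfolding face_of_def using sub convex_ray ext by blast
  moreover have "v \<noteq> 0" using vC by auto
  ultimately show ?thesis unfolding extreme_ray_def by blast
qed

text \<open>The cone is the cone over its slice K, which is compact and hence the convex hull of its
  extreme points; these span extreme rays. Leaving D arbitrary lets the lemma serve for the span of
  the generators as well as for images and preimages of the cone.\<close>

lemma extreme_rays_generate:
  fixes C D :: "(real ^ 'n) set"
  assumes C: "polyhedral_cone C" "pointed C"
    and D: "convex D" "0 \<in> D" "\<And>x t. x \<in> D \<Longrightarrow> 0 \<le> t \<Longrightarrow> t *\<^sub>R x \<in> D"
    and rays: "\<And>r. extreme_ray r C \<Longrightarrow> r \<subseteq> D"
  shows "C \<subseteq> D"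
proof -
  obtain f where f: "\<And>x. x \<in> C \<Longrightarrow> x \<noteq> 0 \<Longrightarrow> 0 < f \<bullet> x"
    using pointed_cone_positive_functional[OF C] by blast
  define K where "K = {x \<in> C. f \<bullet> x = 1}"
  have K_Int: "K = C \<inter> {x. f \<bullet> x = 1}" unfolding K_def by auto
  have convK: "convex K" unfolding K_Int
    by (intro convex_Int polyhedral_cone_convex C convex_hyperplane)
  have closedK: "closed K" unfolding K_Int
    by (intro closed_Int polyhedral_cone_closed C closed_hyperplane)
  have "bounded K"
  \<comment> \<open>A minimum of f on unit vectors of the cone exists only if there are any;
    otherwise the cone is trivial.\<close>
  proof (cases "C \<inter> sphere 0 1 = {}")
    case True
    have "x = 0" if "x \<in> C" for x
    proof (rule ccontr)
      assume "x \<noteq> 0"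
      then have "(1 / norm x) *\<^sub>R x \<in> C \<inter> sphere 0 1"
        using polyhedral_cone_scaleR[OF C(1) that, of "1 / norm x"] by simp
      then show False using True by blast
    qed
    then have "K \<subseteq> {0}" unfolding K_def by auto
    then show ?thesis by (meson bounded_subset bounded_insert bounded_empty)
  next
    case False
    have "compact (C \<inter> sphere 0 1)"
      by (intro closed_Int_compact polyhedral_cone_closed C compact_sphere)
    moreover have "continuous_on (C \<inter> sphere 0 1) ((\<bullet>) f)"
      by (intro continuous_intros)
    ultimately obtain m where m: "m \<in> C \<inter> sphere 0 1"
        "\<And>y. y \<in> C \<inter> sphere 0 1 \<Longrightarrow> f \<bullet> m \<le> f \<bullet> y"
      using continuous_attains_inf[OF _ False] by blast
    have mpos: "0 < f \<bullet> m" using m(1) by (intro f) auto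
    \<comment> \<open>By homogeneity \<open>f \<bullet> x\<close> is at least
      \<open>f \<bullet> m\<close> times the norm of x, and on K it equals 1.\<close>
    have "norm x \<le> 1 / (f \<bullet> m)" if "x \<in> K" for x
    proof -
      have x: "x \<in> C" "f \<bullet> x = 1" "x \<noteq> 0" using that unfolding K_def by auto
      then have "(1 / norm x) *\<^sub>R x \<in> C \<inter> sphere 0 1"
        using polyhedral_cone_scaleR[OF C(1) x(1), of "1 / norm x"] by simp
      from m(2)[OF this] have "f \<bullet> m \<le> 1 / norm x" using x by simp
      then show ?thesis using x mpos by (simp add: field_simps)
    qed
    then show ?thesis unfolding bounded_iff by blast
  qed
  then have "K = convex hull {x. x extreme_point_of K}"
    using closedK convK by (intro Krein_Milman_Minkowski) (simp_all add: compact_eq_bounded_closed)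
  moreover have "{x. x extreme_point_of K} \<subseteq> D"
    using extreme_point_slice_extreme_ray[OF C(1) f] rays self_in_ray
    unfolding K_def by blast
  ultimately have KD: "K \<subseteq> D" using D(1) by (metis hull_minimal)
  show ?thesis
  proof
    fix x assume x: "x \<in> C"
    show "x \<in> D"
    proof (cases "x = 0")
      case False
      then have p: "0 < f \<bullet> x" using f x by blast
      then have "(1 / (f \<bullet> x)) *\<^sub>R x \<in> K"
        unfolding K_def using polyhedral_cone_scaleR[OF C(1) x] by auto
      then have "(f \<bullet> x) *\<^sub>R ((1 / (f \<bullet> x)) *\<^sub>R x) \<in> D"
        using KD D(3) p by (meson less_imp_le subsetD)
      then show ?thesis using p by simp
    qed (use D in auto)
  qed
qed

section \<open>Eigenvectors, and the determinant as a scale\<close>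

text \<open>A basis of the span can be picked among the eigenvectors in S; B multiplies each
  coordinate in it by a nonzero factor. This later separates the eigenspace of one eigenvalue from
  the span of the other generators.\<close>

lemma scaled_generators_kernel_trivial:
  fixes B :: "real ^ 'n ^ 'n"
  assumes eig: "\<And>w. w \<in> S \<Longrightarrow> B *v w = \<mu> w *\<^sub>R w \<and> \<mu> w \<noteq> 0"
    and x: "x \<in> span S" "B *v x = 0"
  shows "x = 0"
proof -
  obtain T where T: "T \<subseteq> S" "independent T" "span T = span S"
    using maximal_independent_subset[of S]
    by (metis span_eq span_superset subset_trans)
  have fin: "finite T" using T(2) independent_imp_finite by blast
  obtain c where c: "x = (\<Sum>t\<in>T. c t *\<^sub>R t)"
    using x(1) unfolding T(3)[symmetric] span_finite[OF fin] by auto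
  have "B *v x = (\<Sum>t\<in>T. (c t * \<mu> t) *\<^sub>R t)"
    unfolding c vec.sum using eig T(1)
    by (intro sum.cong refl) (auto simp: matrix_vector_mult_scaleR)
  then have "c t * \<mu> t = 0" if "t \<in> T" for t
    using independentD[OF T(2) fin order_refl _ that, of "\<lambda>t. c t * \<mu> t"] x(2) by simp
  then have "c t = 0" if "t \<in> T" for t using that eig T(1) by fastforce
  then show ?thesis unfolding c by simp
qed

text \<open>The root makes the absolute determinant homogeneous of degree one while keeping it
  multiplicative, so it sends t times the identity to t for positive t and thus retracts onto the
  positive scalars.\<close>

definition det_scale :: "real ^ 'n ^ 'n \<Rightarrow> real" where
  "det_scale A = root CARD('n) \<bar>det A\<bar>"

lemma det_scaleR: "det (t *\<^sub>R (A :: real ^ 'n ^ 'n)) = t ^ CARD('n) * det A"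
  using det_rows_mul[of "\<lambda>_. t" "\<lambda>i. A $ i"]
  by (simp add: vec_eq_iff scalar_mult_eq_scaleR scaleR_vec_def)

lemma det_scale_mult: "det_scale (A ** B) = det_scale A * det_scale B"
  unfolding det_scale_def by (simp add: det_mul abs_mult real_root_mult)

lemma det_scale_scaleR: "0 \<le> t \<Longrightarrow> det_scale (t *\<^sub>R A) = t * det_scale A"
  unfolding det_scale_def
  by (simp add: det_scaleR abs_mult real_root_mult real_root_power_cancel)

lemma det_scale_mat_1: "det_scale (mat 1) = 1"
  unfolding det_scale_def by simp

lemma det_scale_pos: "invertible A \<Longrightarrow> 0 < det_scale A"
  unfolding det_scale_def by (simp add: invertible_det_nz)

lemma invertible_inj: "invertible (A :: real ^ 'n ^ 'n) \<Longrightarrow> inj ((*v) A)"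
proof (rule injI)
  fix x y assume "invertible A" "A *v x = A *v y"
  then obtain B where B: "B ** A = mat 1" unfolding invertible_def by blast
  have "B *v (A *v x) = B *v (A *v y)" using \<open>A *v x = A *v y\<close> by simp
  then show "x = y" by (simp add: matrix_vector_mul_assoc B)
qed

lemma invertible_scaleR: "t \<noteq> 0 \<Longrightarrow> invertible A \<Longrightarrow> invertible (t *\<^sub>R (A :: real ^ 'n ^ 'n))"
  by (simp add: invertible_det_nz det_scaleR)

section \<open>The automorphism group of a cone\<close>

lemma GL_cone_carrier: "A \<in> carrier (GL_cone C) \<longleftrightarrow> invertible A \<and> (*v) A ` C = C"
  unfolding GL_cone_def general_linear_group_def by simp

lemma image_matrix_mult: "(*v) (A ** B) ` S = (*v) A ` ((*v) B ` S)"
  by (simp add: image_image matrix_vector_mul_assoc)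

lemma GL_cone_mult_closed:
  "A \<in> carrier (GL_cone C) \<Longrightarrow> B \<in> carrier (GL_cone C) \<Longrightarrow> A ** B \<in> carrier (GL_cone C)"
  unfolding GL_cone_carrier by (simp add: image_matrix_mult invertible_mult)

lemma GL_cone_inverse:
  assumes "A \<in> carrier (GL_cone C)"
  obtains B where "B \<in> carrier (GL_cone C)" "A ** B = mat 1" "B ** A = mat 1"
proof -
  obtain B where B: "A ** B = mat 1" "B ** A = mat 1"
    using assms unfolding GL_cone_carrier invertible_def by blast
  have "(*v) B ` C = (*v) B ` ((*v) A ` C)" using assms unfolding GL_cone_carrier by simp
  also have "\<dots> = C" unfolding image_matrix_mult[symmetric] B by simp
  finally have "B \<in> carrier (GL_cone C)"
    unfolding GL_cone_carrier invertible_def using B by blast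
  then show thesis using that B by blast
qed

lemma GL_cone_mat_1: "mat 1 \<in> carrier (GL_cone C)"
  unfolding GL_cone_carrier by (simp add: invertible_det_nz)

lemma GL_cone_scaleR:
  assumes C: "polyhedral_cone C" and A: "A \<in> carrier (GL_cone C)" and t: "0 < t"
  shows "t *\<^sub>R A \<in> carrier (GL_cone C)"
proof -
  have "(*v) (t *\<^sub>R A) ` C = (*\<^sub>R) t ` ((*v) A ` C)"
    by (simp add: image_image scaleR_matrix_vector_assoc)
  also have "\<dots> = (*\<^sub>R) t ` C" using A unfolding GL_cone_carrier by simp
  also have "\<dots> = C"
  proof
    show "(*\<^sub>R) t ` C \<subseteq> C" using polyhedral_cone_scaleR[OF C] t by auto
    show "C \<subseteq> (*\<^sub>R) t ` C"
    proof
      fix x assume "x \<in> C"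
      then have "(1 / t) *\<^sub>R x \<in> C" using polyhedral_cone_scaleR[OF C] t by simp
      moreover have "x = t *\<^sub>R ((1 / t) *\<^sub>R x)" using t by simp
      ultimately show "x \<in> (*\<^sub>R) t ` C" by blast
    qed
  qed
  finally show ?thesis using A t unfolding GL_cone_carrier by (simp add: invertible_scaleR)
qed

text \<open>An injective linear map carries faces of the cone to faces of its image, which is the
  cone again.\<close>

lemma extreme_ray_image:
  assumes "A \<in> carrier (GL_cone C)" "extreme_ray r C"
  shows "extreme_ray ((*v) A ` r) C"
proof -
  have inj: "inj ((*v) A)" and AC: "(*v) A ` C = C"
    using assms invertible_inj unfolding GL_cone_carrier by auto
  obtain v where v: "v \<noteq> 0" "r = ray v" using assms unfolding extreme_ray_def by blast
  have "(*v) A ` r face_of (*v) A ` C"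
    using assms(2) inj unfolding extreme_ray_def by (simp add: face_of_linear_image)
  moreover have "A *v v \<noteq> 0" using inj v(1) by (metis injD matrix_vector_mult_0_right)
  ultimately show ?thesis
    unfolding extreme_ray_def AC v(2) matrix_image_ray by blast
qed

section \<open>Generators of the rays, and automorphisms fixing every ray\<close>

locale nondecomposable_cone =
  fixes C :: "(real ^ 'n) set" and p :: nat and R :: "nat \<Rightarrow> (real ^ 'n) set"
  assumes polyhedral: "polyhedral_cone C"
    and full: "full_dimensional C"
    and pointed: "pointed C"
    and nondecomposable: "\<not> decomposable C"
    and rays: "bij_betw R {1..p} {r. extreme_ray r C}"
begin

text \<open>An arbitrary choice with no symmetry; \<open>avg_gen\<close> later symmetrises
  it.\<close>

definition gen :: "nat \<Rightarrow> real ^ 'n" where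
  "gen i = (SOME v. v \<noteq> 0 \<and> R i = ray v)"

lemma extreme_ray_R: "i \<in> {1..p} \<Longrightarrow> extreme_ray (R i) C"
  using bij_betwE[OF rays] by simp

lemma gen: assumes "i \<in> {1..p}" shows "gen i \<noteq> 0" "R i = ray (gen i)"
proof -
  have "\<exists>v. v \<noteq> 0 \<and> R i = ray v" using extreme_ray_R[OF assms] unfolding extreme_ray_def by blast
  then have "gen i \<noteq> 0 \<and> R i = ray (gen i)" unfolding gen_def by (rule someI_ex)
  then show "gen i \<noteq> 0" "R i = ray (gen i)" by auto
qed

lemma R_inj: "i \<in> {1..p} \<Longrightarrow> j \<in> {1..p} \<Longrightarrow> R i = R j \<Longrightarrow> i = j"
  using inj_onD[OF bij_betw_imp_inj_on[OF rays]] by simp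

lemma extreme_rayE:
  assumes "extreme_ray r C" obtains i where "i \<in> {1..p}" "r = R i"
proof -
  have "r \<in> R ` {1..p}" using assms bij_betw_imp_surj_on[OF rays] by simp
  then show thesis using that by blast
qed

text \<open>The span is a convex cone containing all extreme rays, hence the cone; being affine, it
  also contains the affine hull, which is everything by full dimension.\<close>

lemma span_gen: "span (gen ` {1..p}) = UNIV"
proof -
  have "C \<subseteq> span (gen ` {1..p})"
  proof (rule extreme_rays_generate[OF polyhedral pointed])
    fix r assume "extreme_ray r C"
    then obtain i where i: "i \<in> {1..p}" "r = R i" by (rule extreme_rayE)
    have "gen i \<in> span (gen ` {1..p})" using i by (intro span_base) blast
    then show "r \<subseteq> span (gen ` {1..p})"
      unfolding i(2) gen(2)[OF i(1)] ray_def by (auto intro: span_mul)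
  qed (auto intro: span_mul span_zero subspace_imp_convex)
  moreover have "affine hull C = UNIV"
    using full unfolding full_dimensional_def by (intro affine_hull_UNIV) simp
  ultimately show ?thesis
    by (metis hull_minimal subspace_imp_affine subspace_span top.extremum_uniqueI)
qed

text \<open>The eigenspace of one ray's eigenvalue and the span of the rays with other eigenvalues
  would decompose the cone.\<close>

lemma fixes_rays_imp_scalar:
  assumes A: "A \<in> carrier (GL_cone C)"
    and fixed: "\<And>i. i \<in> {1..p} \<Longrightarrow> (*v) A ` R i = R i"
  obtains t where "0 < t" "A = t *\<^sub>R mat 1"
proof -
  have "\<exists>l. 0 < l \<and> A *v gen i = l *\<^sub>R gen i" if i: "i \<in> {1..p}" for i
  proof -
    have "A *v gen i \<noteq> 0"
      using A gen(1)[OF i] invertible_inj unfolding GL_cone_carrier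
      by (metis injD matrix_vector_mult_0_right)
    moreover have "A *v gen i \<in> ray (gen i)"
      using fixed[OF i] unfolding gen(2)[OF i] matrix_image_ray by (metis self_in_ray)
    ultimately show ?thesis using in_ray_nonzeroE by metis
  qed
  then obtain l where l: "\<And>i. i \<in> {1..p} \<Longrightarrow> 0 < l i \<and> A *v gen i = l i *\<^sub>R gen i"
    by metis
  \<comment> \<open>Without rays the generators would span only 0, but the space has a nonzero axis
    vector.\<close>
  have "{1..p} \<noteq> {}"
  proof
    assume "{1..p} = {}"
    then have "(UNIV :: (real ^ 'n) set) = {0}" using span_gen by simp
    moreover have "axis k 1 \<noteq> (0 :: real ^ 'n)" for k by (simp add: axis_eq_0_iff)
    ultimately show False by blast
  qed
  then obtain k where k: "k \<in> {1..p}" by blast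
  \<comment> \<open>Subtracting the eigenvalue of ray k kills the generators in S and scales those
    in T by nonzero factors.\<close>
  define B where "B = A - l k *\<^sub>R mat 1"
  have Bx: "B *v x = A *v x - l k *\<^sub>R x" for x
    unfolding B_def by (simp add: matrix_vector_mult_diff_rdistrib flip: scaleR_matrix_vector_assoc)
  define S T where "S = gen ` {i \<in> {1..p}. l i = l k}" and "T = gen ` {i \<in> {1..p}. l i \<noteq> l k}"
  have ST: "S \<union> T = gen ` {1..p}" unfolding S_def T_def by blast
  have B0: "B *v x = 0" if "x \<in> span S" for x
    using that
  proof (induction rule: span_induct_alt)
    case (step c x y)
    then have "B *v x = 0" unfolding S_def Bx using l by auto
    with step show ?case by (simp add: matrix_vector_right_distrib matrix_vector_mult_scaleR)
  qed simp
  have "\<exists>m. B *v w = m *\<^sub>R w \<and> m \<noteq> 0" if "w \<in> T" for w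
  proof -
    obtain i where "i \<in> {1..p}" "l i \<noteq> l k" "w = gen i" using \<open>w \<in> T\<close> unfolding T_def by blast
    then show ?thesis
      unfolding Bx using l by (intro exI[of _ "l i - l k"]) (simp add: scaleR_diff_left)
  qed
  then obtain m where m: "\<And>w. w \<in> T \<Longrightarrow> B *v w = m w *\<^sub>R w \<and> m w \<noteq> 0" by metis
  \<comment> \<open>B vanishes on \<open>span S\<close> and has trivial kernel on
    \<open>span T\<close>.\<close>
  have Int0: "span S \<inter> span T = {0}"
    using B0 scaled_generators_kernel_trivial[OF m] span_zero by blast
  have sum: "{x + y | x y. x \<in> span S \<and> y \<in> span T} = UNIV"
    using span_gen unfolding ST[symmetric] span_Un by simp
  have S0: "span S \<noteq> {0}"
    using k gen(1)[OF k] span_base[of "gen k" S] unfolding S_def by auto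
  have split: "r \<subseteq> span S \<or> r \<subseteq> span T" if r: "extreme_ray r C" for r
  proof -
    obtain i where i: "i \<in> {1..p}" "r = R i" using extreme_rayE[OF r] .
    have "ray (gen i) \<subseteq> span U" if "gen i \<in> U" for U
      using that unfolding ray_def by (auto intro: span_mul span_base)
    moreover have "gen i \<in> S \<or> gen i \<in> T" using i ST by blast
    ultimately show ?thesis unfolding i(2) gen(2)[OF i(1)] by blast
  qed
  have "span T = {0}"
  proof (rule ccontr)
    assume "span T \<noteq> {0}"
    then have "decomposable C"
      unfolding decomposable_def
      using Int0 sum S0 split by (intro exI[of _ "span S"] exI[of _ "span T"]) auto
    then show False using nondecomposable by simp
  qed
  then have "span S = UNIV" using sum by auto
  then have "A *v x = (l k *\<^sub>R mat 1) *v x" for x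
    using B0[of x] unfolding Bx by (simp flip: scaleR_matrix_vector_assoc)
  then have "A = l k *\<^sub>R mat 1" by (simp add: matrix_eq)
  then show thesis using that l k by blast
qed

section \<open>The permutation of rays induced by an automorphism\<close>

lemma ex_ray_perm:
  assumes A: "A \<in> carrier (GL_cone C)"
  shows "\<exists>\<sigma>. \<sigma> permutes {1..p} \<and> (\<forall>i\<in>{1..p}. (*v) A ` R i = R (\<sigma> i))"
proof -
  have "\<exists>j. j \<in> {1..p} \<and> (*v) A ` R i = R j" if "i \<in> {1..p}" for i
    using extreme_ray_image[OF A extreme_ray_R[OF that]] extreme_rayE by metis
  then obtain s where s: "\<And>i. i \<in> {1..p} \<Longrightarrow> s i \<in> {1..p} \<and> (*v) A ` R i = R (s i)"
    by metis
  have "inj_on s {1..p}"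
  proof (rule inj_onI)
    fix i j assume ij: "i \<in> {1..p}" "j \<in> {1..p}" "s i = s j"
    then have "(*v) A ` R i = (*v) A ` R j" using s by metis
    then have "R i = R j" using invertible_inj A unfolding GL_cone_carrier
      by (metis inj_image_eq_iff)
    then show "i = j" using R_inj ij by blast
  qed
  moreover have "s ` {1..p} \<subseteq> {1..p}" using s by blast
  ultimately have "bij_betw s {1..p} {1..p}"
    unfolding bij_betw_def using endo_inj_surj by blast
  \<comment> \<open>\<open>s\<close> is arbitrary off the index set, whereas \<open>permutes\<close>
    demands the identity there.\<close>
  then have "restrict_id s {1..p} permutes {1..p}" by (rule permutes_restrict_id)
  then show ?thesis using s by (intro exI[of _ "restrict_id s {1..p}"]) auto
qed

lemma ray_perm_unique:
  assumes "\<sigma> permutes {1..p}" "\<tau> permutes {1..p}"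
    and "\<And>i. i \<in> {1..p} \<Longrightarrow> R (\<sigma> i) = R (\<tau> i)"
  shows "\<sigma> = \<tau>"
proof
  fix i
  show "\<sigma> i = \<tau> i"
  proof (cases "i \<in> {1..p}")
    case True
    then have "\<sigma> i \<in> {1..p}" "\<tau> i \<in> {1..p}"
      using permutes_in_image[OF assms(1)] permutes_in_image[OF assms(2)] by blast+
    then show ?thesis using R_inj assms(3)[OF True] by blast
  next
    case False
    then show ?thesis using permutes_not_in[OF assms(1)] permutes_not_in[OF assms(2)] by simp
  qed
qed

text \<open>For automorphisms of the cone the choice has exactly one candidate, by
  \<open>ex_ray_perm\<close> and \<open>ray_perm_unique\<close>.\<close>

definition ray_perm :: "real ^ 'n ^ 'n \<Rightarrow> nat \<Rightarrow> nat" where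
  "ray_perm A = (SOME \<sigma>. \<sigma> permutes {1..p} \<and> (\<forall>i\<in>{1..p}. (*v) A ` R i = R (\<sigma> i)))"

lemma ray_perm:
  assumes "A \<in> carrier (GL_cone C)"
  shows "ray_perm A permutes {1..p}" "i \<in> {1..p} \<Longrightarrow> (*v) A ` R i = R (ray_perm A i)"
proof -
  have "ray_perm A permutes {1..p} \<and> (\<forall>i\<in>{1..p}. (*v) A ` R i = R (ray_perm A i))"
    unfolding ray_perm_def by (rule someI_ex[OF ex_ray_perm[OF assms]])
  then show "ray_perm A permutes {1..p}" "i \<in> {1..p} \<Longrightarrow> (*v) A ` R i = R (ray_perm A i)"
    by (rule conjunct1, rule bspec[OF conjunct2])
qed

lemma ray_perm_eqI:
  assumes "A \<in> carrier (GL_cone C)" "\<sigma> permutes {1..p}"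
    and "\<And>i. i \<in> {1..p} \<Longrightarrow> (*v) A ` R i = R (\<sigma> i)"
  shows "ray_perm A = \<sigma>"
proof (rule ray_perm_unique[OF ray_perm(1)[OF assms(1)] assms(2)])
  fix i assume i: "i \<in> {1..p}"
  show "R (ray_perm A i) = R (\<sigma> i)" using ray_perm(2)[OF assms(1) i] assms(3)[OF i] by simp
qed

lemma ray_perm_mult:
  assumes A: "A \<in> carrier (GL_cone C)" and B: "B \<in> carrier (GL_cone C)"
  shows "ray_perm (A ** B) = ray_perm A \<circ> ray_perm B"
proof (rule ray_perm_eqI[OF GL_cone_mult_closed[OF A B]])
  show "ray_perm A \<circ> ray_perm B permutes {1..p}"
    by (intro permutes_compose ray_perm(1) A B)
  fix i assume i: "i \<in> {1..p}"
  then have "ray_perm B i \<in> {1..p}" using permutes_in_image[OF ray_perm(1)[OF B]] by simp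
  then show "(*v) (A ** B) ` R i = R ((ray_perm A \<circ> ray_perm B) i)"
    unfolding image_matrix_mult ray_perm(2)[OF B i] by (simp add: ray_perm(2)[OF A])
qed

lemma ray_perm_scaleR:
  assumes A: "A \<in> carrier (GL_cone C)" and t: "0 < t"
  shows "ray_perm (t *\<^sub>R A) = ray_perm A"
proof (rule ray_perm_eqI[OF GL_cone_scaleR[OF polyhedral A t] ray_perm(1)[OF A]])
  fix i assume i: "i \<in> {1..p}"
  have "(*v) (t *\<^sub>R A) ` R i = (*v) A ` R i"
    unfolding gen(2)[OF i] matrix_image_ray scaleR_matrix_vector_assoc[symmetric]
    by (rule ray_scaleR[OF t])
  then show "(*v) (t *\<^sub>R A) ` R i = R (ray_perm A i)" using ray_perm(2)[OF A i] by simp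
qed

text \<open>The quotient of A by B fixes every ray and so is a positive scalar; equal determinant
  scales force that scalar to be 1.\<close>

lemma ray_perm_det_scale_inj:
  assumes A: "A \<in> carrier (GL_cone C)" and B: "B \<in> carrier (GL_cone C)"
    and perm: "ray_perm A = ray_perm B" and det: "det_scale A = det_scale B"
  shows "A = B"
proof -
  obtain B' where B': "B' \<in> carrier (GL_cone C)" "B ** B' = mat 1" "B' ** B = mat 1"
    using GL_cone_inverse[OF B] .
  have "(*v) (B' ** A) ` R i = R i" if i: "i \<in> {1..p}" for i
  proof -
    have "(*v) A ` R i = (*v) B ` R i"
      by (simp only: ray_perm(2)[OF A i] ray_perm(2)[OF B i] perm)
    then have "(*v) (B' ** A) ` R i = (*v) (B' ** B) ` R i"
      by (simp only: image_matrix_mult)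
    also have "\<dots> = R i" by (simp add: B'(3))
    finally show ?thesis .
  qed
  then obtain t where t: "0 < t" "B' ** A = t *\<^sub>R mat 1"
    using fixes_rays_imp_scalar[OF GL_cone_mult_closed[OF B'(1) A]] by blast
  have "A = B ** (B' ** A)" by (simp add: matrix_mul_assoc B')
  then have At: "A = t *\<^sub>R B"
    unfolding t(2) by (simp add: matrix_scalar_ac flip: scalar_matrix_assoc)
  then have "det_scale B = t * det_scale B" using det t det_scale_scaleR[of t B] by simp
  then have "t = 1" using det_scale_pos[of B] B unfolding GL_cone_carrier by simp
  then show ?thesis using At by simp
qed

section \<open>The projective group and the product decomposition\<close>

lemma Proj_group_carrier: "carrier (Proj_group C p R) = ray_perm ` carrier (GL_cone C)"
proof -
  have "carrier (Proj_group C p R) = {\<sigma>. \<sigma> permutes {1..p} \<and>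
      (\<exists>A\<in>carrier (GL_cone C). \<forall>i\<in>{1..p}. (*v) A ` R i = R (\<sigma> i))}"
    unfolding Proj_group_def by (auto simp: sym_group_carrier)
  also have "\<dots> = ray_perm ` carrier (GL_cone C)"
  proof (intro equalityI subsetI)
    fix \<sigma> assume "\<sigma> \<in> ray_perm ` carrier (GL_cone C)"
    then obtain A where A: "A \<in> carrier (GL_cone C)" "\<sigma> = ray_perm A" by blast
    then show "\<sigma> \<in> {\<sigma>. \<sigma> permutes {1..p} \<and>
        (\<exists>A\<in>carrier (GL_cone C). \<forall>i\<in>{1..p}. (*v) A ` R i = R (\<sigma> i))}"
      using ray_perm[OF A(1)] by blast
  next
    fix \<sigma> assume "\<sigma> \<in> {\<sigma>. \<sigma> permutes {1..p} \<and>
        (\<exists>A\<in>carrier (GL_cone C). \<forall>i\<in>{1..p}. (*v) A ` R i = R (\<sigma> i))}"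
    then obtain A where A: "A \<in> carrier (GL_cone C)" "\<sigma> permutes {1..p}"
      "\<forall>i\<in>{1..p}. (*v) A ` R i = R (\<sigma> i)" by blast
    then have "ray_perm A = \<sigma>" by (intro ray_perm_eqI) auto
    then show "\<sigma> \<in> ray_perm ` carrier (GL_cone C)" using A(1) by blast
  qed
  finally show ?thesis .
qed

text \<open>Rescaling an automorphism by a positive factor keeps its ray permutation and multiplies
  \<open>det_scale\<close> by that factor, so the two invariants can be prescribed
  independently.\<close>

lemma ex_det_scale_ray_perm:
  assumes "\<sigma> \<in> carrier (Proj_group C p R)" and t: "0 < t"
  obtains A where "A \<in> carrier (GL_cone C)" "ray_perm A = \<sigma>" "det_scale A = t"
proof -
  obtain A where A: "A \<in> carrier (GL_cone C)" "ray_perm A = \<sigma>"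
    using assms unfolding Proj_group_carrier by blast
  have d: "0 < det_scale A" using A det_scale_pos unfolding GL_cone_carrier by blast
  define s where "s = t / det_scale A"
  have "0 < s" unfolding s_def using d t by simp
  then have "s *\<^sub>R A \<in> carrier (GL_cone C)" "ray_perm (s *\<^sub>R A) = \<sigma>" "det_scale (s *\<^sub>R A) = t"
    using A d GL_cone_scaleR[OF polyhedral] ray_perm_scaleR det_scale_scaleR[of s A]
    by (auto simp: s_def)
  then show thesis using that by blast
qed

lemma GL_cone_iso: "GL_cone C \<cong> pos_real_group \<times>\<times> Proj_group C p R"
proof -
  let ?h = "\<lambda>A. (det_scale A, ray_perm A)"
  have car: "carrier (pos_real_group \<times>\<times> Proj_group C p R) = {0<..} \<times> carrier (Proj_group C p R)"
    unfolding DirProd_def pos_real_group_def by auto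
  have mem: "?h A \<in> carrier (pos_real_group \<times>\<times> Proj_group C p R)" if "A \<in> carrier (GL_cone C)" for A
    using that det_scale_pos[of A] by (simp add: pos_real_group_def Proj_group_carrier GL_cone_carrier)
  have "?h \<in> hom (GL_cone C) (pos_real_group \<times>\<times> Proj_group C p R)"
  proof (rule homI[OF mem])
    fix A B assume AB: "A \<in> carrier (GL_cone C)" "B \<in> carrier (GL_cone C)"
    have "A \<otimes>\<^bsub>GL_cone C\<^esub> B = A ** B"
      unfolding GL_cone_def general_linear_group_def by simp
    then show "?h (A \<otimes>\<^bsub>GL_cone C\<^esub> B) = ?h A \<otimes>\<^bsub>pos_real_group \<times>\<times> Proj_group C p R\<^esub> ?h B"
      using ray_perm_mult[OF AB]
      by (simp add: det_scale_mult pos_real_group_def Proj_group_def sym_group_mult)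
  qed
  moreover have "bij_betw ?h (carrier (GL_cone C)) (carrier (pos_real_group \<times>\<times> Proj_group C p R))"
  proof (rule bij_betw_imageI)
    show "inj_on ?h (carrier (GL_cone C))"
      by (rule inj_onI) (simp add: ray_perm_det_scale_inj)
    show "?h ` carrier (GL_cone C) = carrier (pos_real_group \<times>\<times> Proj_group C p R)"
    proof
      show "?h ` carrier (GL_cone C) \<subseteq> carrier (pos_real_group \<times>\<times> Proj_group C p R)"
        using mem by blast
      show "carrier (pos_real_group \<times>\<times> Proj_group C p R) \<subseteq> ?h ` carrier (GL_cone C)"
      proof
        fix x assume "x \<in> carrier (pos_real_group \<times>\<times> Proj_group C p R)"
        then obtain t \<sigma> where x: "x = (t, \<sigma>)" "0 < t" "\<sigma> \<in> carrier (Proj_group C p R)"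
          unfolding car by auto
        obtain A where "A \<in> carrier (GL_cone C)" "ray_perm A = \<sigma>" "det_scale A = t"
          using ex_det_scale_ray_perm[OF x(3,2)] .
        then show "x \<in> ?h ` carrier (GL_cone C)" unfolding x(1) by blast
      qed
    qed
  qed
  ultimately show ?thesis unfolding is_iso_def iso_def by blast
qed

section \<open>Equivariant generators by averaging\<close>

text \<open>The kernel of \<open>det_scale\<close>, a complement to the positive scalars on which
  \<open>ray_perm\<close> is injective.\<close>

definition unit_GL :: "(real ^ 'n ^ 'n) set" where
  "unit_GL = {A \<in> carrier (GL_cone C). det_scale A = 1}"

lemma finite_unit_GL: "finite unit_GL"
proof (rule inj_on_finite)
  show "inj_on ray_perm unit_GL"
    by (rule inj_onI) (use ray_perm_det_scale_inj in \<open>auto simp: unit_GL_def\<close>)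
  show "ray_perm ` unit_GL \<subseteq> {\<sigma>. \<sigma> permutes {1..p}}"
    using ray_perm(1) unfolding unit_GL_def by blast
  show "finite {\<sigma>. \<sigma> permutes {1..p}}" by (simp add: finite_permutations)
qed

text \<open>Averaging the generators over the finite group of automorphisms of determinant
  \<open>\<plusminus>1\<close> makes the choice of generators equivariant.\<close>

definition avg_gen :: "nat \<Rightarrow> real ^ 'n" where
  "avg_gen i = (\<Sum>A\<in>unit_GL. A *v gen (inv' (ray_perm A) i))"

text \<open>Each A maps the generator of the ray it carries to \<open>R i\<close> onto a positive
  multiple of \<open>gen i\<close>, and such multiples cannot cancel.\<close>

lemma avg_gen_ray:
  assumes i: "i \<in> {1..p}"
  shows "R i = ray (avg_gen i)"
proof -
  have "\<exists>s. 0 < s \<and> A *v gen (inv' (ray_perm A) i) = s *\<^sub>R gen i" if "A \<in> unit_GL" for A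
  proof -
    have A: "A \<in> carrier (GL_cone C)" using that unfolding unit_GL_def by blast
    let ?j = "inv' (ray_perm A) i"
    have j: "?j \<in> {1..p}" "ray_perm A ?j = i"
      using permutes_in_image[OF permutes_inv[OF ray_perm(1)[OF A]]] i
        permutes_inverses(1)[OF ray_perm(1)[OF A]] by blast+
    have "A *v gen ?j \<in> (*v) A ` R ?j" unfolding gen(2)[OF j(1)] using self_in_ray by blast
    then have "A *v gen ?j \<in> ray (gen i)" using ray_perm(2)[OF A j(1)] j(2) gen(2)[OF i] by simp
    moreover have "A *v gen ?j \<noteq> 0"
      using A gen(1)[OF j(1)] invertible_inj unfolding GL_cone_carrier
      by (metis injD matrix_vector_mult_0_right)
    ultimately show ?thesis using in_ray_nonzeroE by metis
  qed
  then obtain s where s: "\<And>A. A \<in> unit_GL \<Longrightarrow>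
      0 < s A \<and> A *v gen (inv' (ray_perm A) i) = s A *\<^sub>R gen i"
    by metis
  have "avg_gen i = (\<Sum>A\<in>unit_GL. s A) *\<^sub>R gen i"
    unfolding avg_gen_def scaleR_sum_left using s by (intro sum.cong) auto
  \<comment> \<open>The identity makes the sum nonempty, hence its coefficient strictly
    positive.\<close>
  moreover have "mat 1 \<in> unit_GL" unfolding unit_GL_def by (simp add: GL_cone_mat_1 det_scale_mat_1)
  then have "0 < (\<Sum>A\<in>unit_GL. s A)"
    using s finite_unit_GL by (intro sum_pos) auto
  ultimately show ?thesis
    using gen(2)[OF i] ray_scaleR[of "\<Sum>A\<in>unit_GL. s A" "gen i"] by simp
qed

text \<open>Left multiplication by B permutes the finite group, so the average may be reindexed
  along it.\<close>

lemma avg_gen_equivariant: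
  assumes B: "B \<in> unit_GL"
  shows "B *v avg_gen i = avg_gen (ray_perm B i)"
proof -
  have BG: "B \<in> carrier (GL_cone C)" using B unfolding unit_GL_def by blast
  obtain B' where B': "B' ** B = mat 1" using GL_cone_inverse[OF BG] by blast
  have inj: "inj_on ((**) B) unit_GL"
    by (rule inj_onI) (metis B' matrix_mul_assoc matrix_mul_lid)
  moreover have "(**) B ` unit_GL \<subseteq> unit_GL"
    using B unfolding unit_GL_def by (auto simp: GL_cone_mult_closed det_scale_mult)
  ultimately have img: "(**) B ` unit_GL = unit_GL"
    using endo_inj_surj finite_unit_GL by blast
  have "avg_gen (ray_perm B i) =
      (\<Sum>A\<in>(**) B ` unit_GL. A *v gen (inv' (ray_perm A) (ray_perm B i)))"
    unfolding img avg_gen_def ..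
  also have "\<dots> = (\<Sum>A\<in>unit_GL. (B ** A) *v gen (inv' (ray_perm (B ** A)) (ray_perm B i)))"
    by (simp add: sum.reindex[OF inj])
  also have "\<dots> = (\<Sum>A\<in>unit_GL. B *v (A *v gen (inv' (ray_perm A) i)))"
  proof (rule sum.cong[OF refl])
    fix A assume "A \<in> unit_GL"
    then have AG: "A \<in> carrier (GL_cone C)" unfolding unit_GL_def by blast
    note bA = permutes_bij[OF ray_perm(1)[OF AG]] and bB = permutes_bij[OF ray_perm(1)[OF BG]]
    \<comment> \<open>The inverse of the composite undoes B first, cancelling the shift of i by
      B.\<close>
    have "inv' (ray_perm (B ** A)) (ray_perm B i) = inv' (ray_perm A) i"
      unfolding ray_perm_mult[OF BG AG] o_inv_distrib[OF bB bA]
      using bB by (simp add: bij_is_inj)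
    then show "(B ** A) *v gen (inv' (ray_perm (B ** A)) (ray_perm B i)) =
        B *v (A *v gen (inv' (ray_perm A) i))"
      by (simp add: matrix_vector_mul_assoc)
  qed
  also have "\<dots> = B *v avg_gen i" unfolding avg_gen_def by (rule vec.sum[symmetric])
  finally show ?thesis ..
qed

text \<open>A matrix permuting the generators permutes the extreme rays; as these generate the cone,
  it maps the cone onto itself.\<close>

lemma permutes_generators_imp_GL_cone:
  assumes v: "\<And>i. i \<in> {1..p} \<Longrightarrow> R i = ray (v i)"
    and \<sigma>: "\<sigma> permutes {1..p}" and A: "invertible A"
    and Av: "\<And>i. i \<in> {1..p} \<Longrightarrow> A *v v i = v (\<sigma> i)"
  shows "A \<in> carrier (GL_cone C)"
proof -
  note sc = polyhedral_cone_scaleR[OF polyhedral]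
  have AR: "(*v) A ` R i = R (\<sigma> i)" if "i \<in> {1..p}" for i
    using v[of "\<sigma> i"] that permutes_in_image[OF \<sigma>]
    unfolding v[OF that] matrix_image_ray Av[OF that] by simp
  have RC: "R i \<subseteq> C" if "i \<in> {1..p}" for i
    using extreme_ray_R[OF that] face_of_imp_subset unfolding extreme_ray_def by blast
  have zero: "0 \<in> C" using polyhedral unfolding polyhedral_cone_def by auto
  \<comment> \<open>The preimage is a convex cone containing every ray, so A maps the cone into
    itself.\<close>
  have "C \<subseteq> (*v) A -` C"
  proof (rule extreme_rays_generate[OF polyhedral pointed])
    show "convex ((*v) A -` C)"
      by (intro convex_linear_vimage polyhedral_cone_convex polyhedral) simp
    fix r assume "extreme_ray r C"
    then obtain i where i: "i \<in> {1..p}" "r = R i" by (rule extreme_rayE)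
    then show "r \<subseteq> (*v) A -` C" using AR[OF i(1)] RC permutes_in_image[OF \<sigma>] by blast
  qed (use sc zero in \<open>auto simp: matrix_vector_mult_scaleR\<close>)
  \<comment> \<open>Conversely every ray is the image of the ray with index
    \<open>inv' \<sigma> i\<close>, so the image of the cone contains all rays.\<close>
  moreover have "C \<subseteq> (*v) A ` C"
  proof (rule extreme_rays_generate[OF polyhedral pointed])
    show "convex ((*v) A ` C)"
      by (intro convex_linear_image polyhedral_cone_convex polyhedral) simp
    show "0 \<in> (*v) A ` C" using zero by (force simp: image_iff)
    show "t *\<^sub>R x \<in> (*v) A ` C" if "x \<in> (*v) A ` C" "0 \<le> t" for x t
      using that sc by (auto simp: matrix_vector_mult_scaleR[symmetric])
    fix r assume "extreme_ray r C"
    then obtain i where i: "i \<in> {1..p}" "r = R i" by (rule extreme_rayE)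
    have j: "inv' \<sigma> i \<in> {1..p}" "\<sigma> (inv' \<sigma> i) = i"
      using permutes_in_image[OF permutes_inv[OF \<sigma>]] i(1) permutes_inverses(1)[OF \<sigma>] by blast+
    have "r = (*v) A ` R (inv' \<sigma> i)" using AR[OF j(1)] j(2) i(2) by simp
    then show "r \<subseteq> (*v) A ` C" using RC[OF j(1)] by blast
  qed
  ultimately show ?thesis unfolding GL_cone_carrier using A by blast
qed

text \<open>Linear symmetries of the averaged generators preserve the cone; conversely a projective
  symmetry is realised by a matrix of determinant scale 1, under which these generators are
  equivariant.\<close>

lemma Lin_group_avg_gen: "Lin_group p avg_gen = Proj_group C p R"
proof -
  have "(\<exists>A \<in> carrier general_linear_group. \<forall>i\<in>{1..p}. A *v avg_gen i = avg_gen (\<sigma> i)) \<longleftrightarrow>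
      (\<exists>A \<in> carrier (GL_cone C). \<forall>i\<in>{1..p}. (*v) A ` R i = R (\<sigma> i))" (is "?L \<longleftrightarrow> ?P")
    if "\<sigma> \<in> carrier (sym_group p)" for \<sigma>
  proof
    have \<sigma>: "\<sigma> permutes {1..p}" using that by (simp add: sym_group_carrier)
    {
      assume ?L
      then obtain A where A: "invertible A" "\<And>i. i \<in> {1..p} \<Longrightarrow> A *v avg_gen i = avg_gen (\<sigma> i)"
        unfolding general_linear_group_def by auto
      have "A \<in> carrier (GL_cone C)"
        using permutes_generators_imp_GL_cone[OF avg_gen_ray \<sigma> A] .
      moreover have "(*v) A ` R i = R (\<sigma> i)" if "i \<in> {1..p}" for i
        using avg_gen_ray[of "\<sigma> i"] that permutes_in_image[OF \<sigma>]
        unfolding avg_gen_ray[OF that] matrix_image_ray A(2)[OF that] by simp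
      ultimately show ?P by blast
    next
      assume ?P
      then have "\<sigma> \<in> carrier (Proj_group C p R)" using that unfolding Proj_group_def by simp
      then obtain A where A: "A \<in> carrier (GL_cone C)" "ray_perm A = \<sigma>" "det_scale A = 1"
        using ex_det_scale_ray_perm[of \<sigma> 1] by auto
      then have "A *v avg_gen i = avg_gen (\<sigma> i)" for i
        using avg_gen_equivariant[of A i] unfolding unit_GL_def by simp
      moreover have "A \<in> carrier general_linear_group"
        using A(1) unfolding GL_cone_def by simp
      ultimately show ?L by blast
    }
  qed
  then have "{\<sigma> \<in> carrier (sym_group p).
        \<exists>A \<in> carrier general_linear_group. \<forall>i\<in>{1..p}. A *v avg_gen i = avg_gen (\<sigma> i)} =
      {\<sigma> \<in> carrier (sym_group p).
        \<exists>A \<in> carrier (GL_cone C). \<forall>i\<in>{1..p}. (*v) A ` R i = R (\<sigma> i)}"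
    by (intro Collect_cong conj_cong refl)
  then show ?thesis unfolding Lin_group_def Proj_group_def by simp
qed

end

theorem theorem7:
  fixes C :: "(real ^ 'n) set" and p :: nat and R :: "nat \<Rightarrow> (real ^ 'n) set"
  assumes "polyhedral_cone C"
    and "full_dimensional C"
    and "pointed C"
    and "\<not> decomposable C"
    and "bij_betw R {1..p} {r. extreme_ray r C}"
  shows "GL_cone C \<cong> pos_real_group \<times>\<times> Proj_group C p R \<and>
    (\<exists>v :: nat \<Rightarrow> real ^ 'n. (\<forall>i\<in>{1..p}. R i = ray (v i)) \<and>
       Lin_group p v = Proj_group C p R)"
proof -
  interpret nondecomposable_cone C p R
    using assms by unfold_locales
  show ?thesis using GL_cone_iso avg_gen_ray Lin_group_avg_gen by blast
qed

end
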